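(* Let $-A$ be the generator of a bounded $C_0$-semigroup $T$ on a Banach space $X$. Then for every Banach function space $\Phi\in\mathfrak{L}_P$ (that is, every Banach function space $\Phi$ over $\mathbb{R}_+$ such that the Hardy operator $P$ is bounded on $\Phi$), $$(X,D_A)_\Phi=\bigl\{x\in X:\ [(0,\infty)\ni t\mapsto t^{-1}|(T(t)-I)x|_X]\in\Phi\bigr\}$$ and $$|x|_{(X,D_A)_\Phi}\simeq|x|_X+\bigl\|(\cdot)^{-1}|(T(\cdot)-I)x|_X\bigr\|_\Phi\qquad(x\in(X,D_A)_\Phi).$$
   Context: $\mathcal{M}$ is the set of complex measurable functions on $\mathbb{R}_+=[0,\infty)$, equipped with the topology of convergence in Lebesgue measure. A Banach function space over $\mathbb{R}_+$ is a Banach space $\Phi$ that is both a Banach lattice and an order ideal of $\mathcal{M}$: it is a sublattice of $\mathcal{M}$, and $|f|\le|g|$, $g\in\Phi$, $f\in\mathcal{M}$ implies $f\in\Phi$ and $\|f\|_\Phi\le\|g\|_\Phi$. The Hardy operator $P$ is given by $Pf(t)=\frac1t\int_0^t f(s)\,ds$ ($t>0$), with maximal domain $L^1_{loc}$, the space of locally integrable functions on $\mathbb{R}_+$. $\mathfrak{L}_P$ denotes the class of Banach function spaces $\Phi$ over $\mathbb{R}_+$ such that $P$ is bounded on $\Phi$ (in particular $\Phi\subseteq L^1_{loc}$). $D_A$ is the domain of $A$ with the graph norm. For $x\in X+D_A=X$ and $t>0$, $K(t,x)=\inf\{|a|_X+t|b|_{D_A}:a\in X,\ b\in D_A,\ a+b=x\}$,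 and $(X,D_A)_\Phi=\{x\in X:[(0,\infty)\ni t\mapsto t^{-1}K(t,x)]\in\Phi\}$ with norm $|x|_{(X,D_A)_\Phi}=\|(\cdot)^{-1}K(\cdot,x)\|_\Phi$. $I$ is the identity operator on $X$, and $\simeq$ means equivalence up to positive multiplicative constants independent of $x$.
   Formalization: It is additionally assumed that if A has a nonzero kernel vector, then t ↦ min(1,1/t) lies in Φ; otherwise the left-hand space is {0} while the right-hand set contains ker A, e.g. A = 0, T = I, Φ = L^p(1,∞) extended by zero, p > 1. *)

theory Defs
  imports "HOL-Analysis.Analysis"
begin

subsection \<open>Banach function spaces over the half-line\<close>

text \<open>
  A function on the half-line is represented by a function on all of \<^typ>\<open>real\<close>, of which only
  the values on \<^term>\<open>{0..}\<close> matter.  Elements of a function space are classes modulo equality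
  almost everywhere; here a space is the set \<open>\<Phi>\<close> of all representatives, together with a seminorm
  \<open>N\<close> on \<open>\<Phi>\<close> that vanishes exactly on the null functions.
\<close>

abbreviation half_line :: "real measure"
  where "half_line \<equiv> lebesgue_on {0..}"

text \<open>
  The assumption \<open>ideal\<close> makes \<open>\<Phi>\<close> closed under equality almost everywhere and expresses both the
  order ideal property and the monotonicity of the norm.  It makes \<open>\<Phi>\<close> closed under
  \<open>f \<mapsto> \<bar>f\<bar>\<close>, hence a sublattice.
\<close>

locale banach_function_space =
  fixes \<Phi> :: "(real \<Rightarrow> complex) set" and N :: "(real \<Rightarrow> complex) \<Rightarrow> real"
  assumes measurable: "\<Phi> \<subseteq> borel_measurable half_line"
    and zero: "(\<lambda>t. 0) \<in> \<Phi>"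
    and add: "\<lbrakk>f \<in> \<Phi>; g \<in> \<Phi>\<rbrakk> \<Longrightarrow> (\<lambda>t. f t + g t) \<in> \<Phi>"
    and scale: "f \<in> \<Phi> \<Longrightarrow> (\<lambda>t. c * f t) \<in> \<Phi>"
    and norm_nonneg: "f \<in> \<Phi> \<Longrightarrow> 0 \<le> N f"
    and norm_eq_0_iff: "f \<in> \<Phi> \<Longrightarrow> N f = 0 \<longleftrightarrow> (AE t in half_line. f t = 0)"
    and norm_triangle: "\<lbrakk>f \<in> \<Phi>; g \<in> \<Phi>\<rbrakk> \<Longrightarrow> N (\<lambda>t. f t + g t) \<le> N f + N g"
    and norm_scale: "f \<in> \<Phi> \<Longrightarrow> N (\<lambda>t. c * f t) = cmod c * N f"
    and ideal: "\<lbrakk>g \<in> \<Phi>; f \<in> borel_measurable half_line; AE t in half_line. cmod (f t) \<le> cmod (g t)\<rbrakk>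
      \<Longrightarrow> f \<in> \<Phi> \<and> N f \<le> N g"
    and complete: "\<lbrakk>\<And>n. F n \<in> \<Phi>;
        \<And>e. 0 < e \<Longrightarrow> \<exists>n0. \<forall>m\<ge>n0. \<forall>n\<ge>n0. N (\<lambda>t. F m t - F n t) < e\<rbrakk>
      \<Longrightarrow> \<exists>f\<in>\<Phi>. (\<lambda>n. N (\<lambda>t. F n t - f t)) \<longlonglongrightarrow> 0"

definition L1_loc :: "(real \<Rightarrow> complex) set"
  where "L1_loc = {f. \<forall>K. compact K \<and> K \<subseteq> {0..} \<longrightarrow> set_integrable lebesgue K f}"

definition hardy :: "(real \<Rightarrow> complex) \<Rightarrow> real \<Rightarrow> complex"
  where "hardy f t = (LINT s:{0..t}|lebesgue. f s) / complex_of_real t"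

definition hardy_bounded :: "(real \<Rightarrow> complex) set \<Rightarrow> ((real \<Rightarrow> complex) \<Rightarrow> real) \<Rightarrow> bool"
  where "hardy_bounded \<Phi> N \<longleftrightarrow> \<Phi> \<subseteq> L1_loc \<and>
    (\<exists>C. \<forall>f\<in>\<Phi>. hardy f \<in> \<Phi> \<and> N (hardy f) \<le> C * N f)"

subsection \<open>Semigroups and generators\<close>

text \<open>
  Only the operators \<^term>\<open>T t\<close> with \<^term>\<open>0 \<le> t\<close> matter.  The scalars are real; a complex Banach
  space is covered through its underlying real space, since complex linearity of the
  operators plays no role in any of the notions below.
\<close>

definition C0_semigroup :: "(real \<Rightarrow> 'a::banach \<Rightarrow>\<^sub>L 'a) \<Rightarrow> bool"
  where "C0_semigroup T \<longleftrightarrow> T 0 = id_blinfun \<and>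
    (\<forall>s\<ge>0. \<forall>t\<ge>0. T (s + t) = T s o\<^sub>L T t) \<and>
    (\<forall>x. ((\<lambda>t. blinfun_apply (T t) x) \<longlongrightarrow> x) (at_right 0))"

definition bounded_C0_semigroup :: "(real \<Rightarrow> 'a::banach \<Rightarrow>\<^sub>L 'a) \<Rightarrow> bool"
  where "bounded_C0_semigroup T \<longleftrightarrow> C0_semigroup T \<and> (\<exists>M. \<forall>t\<ge>0. norm (T t) \<le> M)"

text \<open>
  An unbounded operator is given by its domain \<open>D\<close> and a function whose values outside \<open>D\<close> are
  irrelevant.
\<close>

definition is_generator ::
    "(real \<Rightarrow> 'a::banach \<Rightarrow>\<^sub>L 'a) \<Rightarrow> 'a set \<Rightarrow> ('a \<Rightarrow> 'a) \<Rightarrow> bool"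
  where "is_generator T D G \<longleftrightarrow>
    D = {x. \<exists>y. ((\<lambda>h. (blinfun_apply (T h) x - x) /\<^sub>R h) \<longlongrightarrow> y) (at_right 0)} \<and>
    (\<forall>x\<in>D. ((\<lambda>h. (blinfun_apply (T h) x - x) /\<^sub>R h) \<longlongrightarrow> G x) (at_right 0))"

subsection \<open>The real interpolation space\<close>

definition graph_norm :: "('a::banach \<Rightarrow> 'a) \<Rightarrow> 'a \<Rightarrow> real"
  where "graph_norm A b = norm b + norm (A b)"

definition K_functional :: "'a::banach set \<Rightarrow> ('a \<Rightarrow> 'a) \<Rightarrow> real \<Rightarrow> 'a \<Rightarrow> real"
  where "K_functional D A t x = Inf {norm a + t * graph_norm A b |a b. b \<in> D \<and> a + b = x}"

definition interp_space ::
    "(real \<Rightarrow> complex) set \<Rightarrow> 'a::banach set \<Rightarrow> ('a \<Rightarrow> 'a) \<Rightarrow> 'a set"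
  where "interp_space \<Phi> D A = {x. (\<lambda>t. complex_of_real (K_functional D A t x / t)) \<in> \<Phi>}"

definition interp_norm ::
    "((real \<Rightarrow> complex) \<Rightarrow> real) \<Rightarrow> 'a::banach set \<Rightarrow> ('a \<Rightarrow> 'a) \<Rightarrow> 'a \<Rightarrow> real"
  where "interp_norm N D A x = N (\<lambda>t. complex_of_real (K_functional D A t x / t))"

text \<open>
  \<open>K(t,x) \<ge> min(1,t) |x|\<close>, so the interpolation space is \<open>{0}\<close> unless the function
  \<open>t \<mapsto> min(1,1/t)\<close> lies in \<open>\<Phi>\<close>.  This does not follow from boundedness of the Hardy
  operator: it fails for \<open>\<Phi> = {0}\<close>, for \<open>L\<^sup>p(1,\<infinity>)\<close> extended by zero, and for
  \<open>L\<^sup>p(t\<^sup>\<alpha> dt)\<close> with \<open>\<alpha> \<le> -1\<close> and \<open>p > 1\<close>.  For such \<open>\<Phi>\<close> the condition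
  \<open>t\<^sup>-\<^sup>1 |(T(t) - I)x| \<in> \<Phi>\<close> still holds for all \<open>x\<close> in the kernel of \<open>A\<close>, and only for these.
  So the description of the interpolation space by the semigroup is correct exactly under the
  following condition.
\<close>

definition kernel_admissible ::
    "(real \<Rightarrow> complex) set \<Rightarrow> 'a::banach set \<Rightarrow> ('a \<Rightarrow> 'a) \<Rightarrow> bool"
  where "kernel_admissible \<Phi> D A \<longleftrightarrow>
    ((\<exists>x\<in>D. A x = 0 \<and> x \<noteq> 0) \<longrightarrow> (\<lambda>t. complex_of_real (min 1 (1 / t))) \<in> \<Phi>)"

end

theory Submission
  imports Defs
begin

text \<open>
  Write \<open>\<omega>(t) = |T(t)x - x|\<close>, \<open>\<phi>(t) = \<omega>(t)/t\<close>, \<open>k(t) = K(t,x)/t\<close> and \<open>m(t) = min(1,1/t)\<close>.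
  Splitting \<open>x = a + b\<close> and using \<open>|T(t)b - b| \<le> M t |Ab|\<close> gives \<open>\<phi> \<le> (M+1) k\<close>, and \<open>m |x| \<le> k\<close>
  is clear.  Conversely, the choice \<open>b = t\<^sup>-\<^sup>1 \<integral>\<^sub>0\<^sup>t T(s)x ds\<close>, for which \<open>-t A b = T(t)x - x\<close>, gives
  \<open>k \<le> P\<phi> + \<phi> + M |x| m\<close>.  Hence everything reduces to \<open>m \<in> \<Phi>\<close>.  If \<open>x\<close> is in the kernel of \<open>A\<close>
  this is assumed.  Otherwise subadditivity of \<open>\<omega>\<close> keeps \<open>\<phi>\<close> away from zero near \<open>0\<close>, so that
  \<open>m \<le> C P\<phi>\<close>.
\<close>

text \<open>One-sided fundamental theorem of calculus: by continuity the mean of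
  \<open>f s - f t\<close> over \<open>{t..t+h}\<close> is small. It serves to compute the generator
  on integrals of orbits.\<close>

lemma integral_average_tendsto:
  fixes f :: "real \<Rightarrow> 'a::banach"
  assumes cont: "continuous_on {t..} f"
  shows "((\<lambda>h. integral {t..t+h} f /\<^sub>R h) \<longlongrightarrow> f t) (at_right 0)"
proof (rule tendstoI)
  fix e :: real assume "e > 0"
  then obtain d where "d > 0" and d: "\<And>s. s \<ge> t \<Longrightarrow> dist s t < d \<Longrightarrow> dist (f s) (f t) < e/2"
    using cont unfolding continuous_on_iff by (metis atLeast_iff half_gt_zero order_refl)
  have "dist (integral {t..t+h} f /\<^sub>R h) (f t) < e" if h: "0 < h" "h < d" for h
  proof -
    have c: "continuous_on {t..t+h} f" using cont by (rule continuous_on_subset) auto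
    have "integral {t..t+h} (\<lambda>s. f s - f t) = integral {t..t+h} f - h *\<^sub>R f t"
      using h by (subst integral_diff) (auto intro: integrable_continuous_real c)
    moreover have "norm (integral {t..t+h} (\<lambda>s. f s - f t)) \<le> e/2 * (t + h - t)"
    proof (rule integral_bound)
      show "continuous_on {t..t+h} (\<lambda>s. f s - f t)" by (intro continuous_intros c)
      show "norm (f s - f t) \<le> e/2" if "s \<in> {t..t+h}" for s
        using d h that by (auto simp: dist_norm less_imp_le)
    qed (use h in auto)
    ultimately have "norm (integral {t..t+h} f - h *\<^sub>R f t) \<le> e/2 * h" by simp
    moreover have "integral {t..t+h} f /\<^sub>R h - f t = (integral {t..t+h} f - h *\<^sub>R f t) /\<^sub>R h"
      using h by (simp add: algebra_simps)
    then have "norm (integral {t..t+h} f /\<^sub>R h - f t) = norm (integral {t..t+h} f - h *\<^sub>R f t) / h"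
      using h by (simp add: divide_inverse_commute)
    ultimately have "dist (integral {t..t+h} f /\<^sub>R h) (f t) \<le> e/2"
      using h by (simp add: dist_norm pos_divide_le_eq)
    then show ?thesis using \<open>e > 0\<close> by simp
  qed
  then show "\<forall>\<^sub>F h in at_right 0. dist (integral {t..t+h} f /\<^sub>R h) (f t) < e"
    using \<open>d > 0\<close> by (auto simp: eventually_at_right_field)
qed

subsection \<open>Banach function spaces\<close>

context banach_function_space
begin

text \<open>The ideal property applied to \<open>c * g\<close>. The pointwise comparisons below are
  turned into membership and norm bounds in this form.\<close>

lemma dominated:
  assumes g: "g \<in> \<Phi>" and f: "f \<in> borel_measurable half_line" and c: "0 \<le> c"
    and le: "\<And>t. 0 \<le> t \<Longrightarrow> cmod (f t) \<le> c * cmod (g t)"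
  shows "f \<in> \<Phi>" and "N f \<le> c * N g"
proof -
  have "f \<in> \<Phi> \<and> N f \<le> N (\<lambda>t. complex_of_real c * g t)"
    by (rule ideal[OF scale[OF g] f]) (use le c in \<open>auto intro!: AE_I2 simp: norm_mult\<close>)
  then show "f \<in> \<Phi>" "N f \<le> c * N g" using norm_scale[OF g, of "complex_of_real c"] c by auto
qed

text \<open>A function of norm zero would vanish almost everywhere on \<open>{0<..<1}\<close>, a set
  of positive measure. Applied to \<open>weight\<close>, this permits division by
  \<open>N weight\<close>.\<close>

lemma norm_pos:
  assumes f: "f \<in> \<Phi>" and "\<And>t. t > 0 \<Longrightarrow> f t \<noteq> 0"
  shows "N f > 0"
proof -
  have "\<not> (AE t in half_line. f t = 0)"
  proof
    assume "AE t in half_line. f t = 0"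
    then have "AE t in lebesgue. t \<in> {0..} \<longrightarrow> f t = 0"
      by (subst (asm) AE_restrict_space_iff) auto
    then have "AE t in lebesgue. t \<notin> {0<..<1::real}"
      by eventually_elim (use assms in force)
    then have "{0<..<1::real} \<in> null_sets lebesgue"
      by (subst AE_iff_null_sets) auto
    then have "emeasure lebesgue {0<..<1::real} = 0" by (rule null_setsD1)
    then show False by simp
  qed
  with norm_nonneg[OF f] norm_eq_0_iff[OF f] show ?thesis by linarith
qed

end

text \<open>Bridge from the complex Lebesgue integral in \<open>hardy\<close> to the real
  Henstock-Kurzweil integral, in which the estimates are carried out.\<close>

lemma hardy_of_real:
  assumes "(\<lambda>s. complex_of_real (g s)) \<in> L1_loc" and "0 \<le> t"
  shows "g integrable_on {0..t}"
    and "hardy (\<lambda>s. complex_of_real (g s)) t = complex_of_real (integral {0..t} g / t)"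
proof -
  have "set_integrable lebesgue {0..t} (\<lambda>s. complex_of_real (g s))"
    using assms unfolding L1_loc_def by auto
  then have i: "set_integrable lebesgue {0..t} g"
    unfolding set_integrable_def
    by (subst complex_of_real_integrable_eq[symmetric]) (simp add: scaleR_conv_of_real)
  show "g integrable_on {0..t}" using i by (rule set_lebesgue_integral_eq_integral)
  show "hardy (\<lambda>s. complex_of_real (g s)) t = complex_of_real (integral {0..t} g / t)"
    using set_lebesgue_integral_eq_integral(2)[OF i]
    by (simp add: hardy_def set_integral_complex_of_real)
qed

subsection \<open>Bounded semigroups\<close>

text \<open>The normalisation \<open>1 \<le> M\<close> permits division by \<open>M\<close> and the
  estimate of \<open>norm x\<close> by \<open>M * norm x\<close>.\<close>

locale bounded_semigroup =
  fixes T :: "real \<Rightarrow> 'a::banach \<Rightarrow>\<^sub>L 'a" and M :: real and D :: "'a set" and A :: "'a \<Rightarrow> 'a"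
  assumes C0: "C0_semigroup T"
    and bound: "0 \<le> t \<Longrightarrow> norm (T t) \<le> M"
    and M_ge_1: "1 \<le> M"
    and gen: "is_generator T D (\<lambda>x. - A x)"
begin

definition displacement :: "'a \<Rightarrow> real \<Rightarrow> real"
  where "displacement x t = norm (T t x - x)"

lemma T_0 [simp]: "T 0 x = x"
  using C0 by (simp add: C0_semigroup_def)

lemma T_add: "0 \<le> s \<Longrightarrow> 0 \<le> t \<Longrightarrow> T (s + t) x = T s (T t x)"
  using C0 by (simp add: C0_semigroup_def)

lemma norm_T_le: "0 \<le> t \<Longrightarrow> norm (T t x) \<le> M * norm x"
  by (meson bound mult_right_mono norm_blinfun norm_ge_zero order_trans)

lemma displacement_nonneg [simp]: "0 \<le> displacement x t"
  by (simp add: displacement_def)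

lemma displacement_0 [simp]: "displacement x 0 = 0"
  by (simp add: displacement_def)

lemma displacement_le: "0 \<le> t \<Longrightarrow> displacement x t \<le> (M + 1) * norm x"
  unfolding displacement_def using norm_T_le[of t x] norm_triangle_ineq4[of "T t x" x]
  by (simp add: algebra_simps)

lemma displacement_triangle: "displacement (a + b) t \<le> displacement a t + displacement b t"
  using norm_triangle_ineq[of "T t a - a" "T t b - b"]
  by (simp add: displacement_def blinfun.add_right algebra_simps)

lemma displacement_tendsto: "(displacement x \<longlongrightarrow> 0) (at_right 0)"
proof -
  have "((\<lambda>t. T t x) \<longlongrightarrow> x) (at_right 0)" using C0 by (simp add: C0_semigroup_def)
  then show ?thesis unfolding displacement_def
    by (rule tendsto_norm_zero[OF LIM_zero])
qed

text \<open>The semigroup law lets \<open>T s\<close> be factored out, so an increment anywhere on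
  the orbit is controlled by the displacement from its start.\<close>

lemma T_diff_le:
  assumes "0 \<le> s" "s \<le> t"
  shows "norm (T t x - T s x) \<le> M * displacement x (t - s)"
proof -
  have "T t x - T s x = T s (T (t - s) x - x)"
    using T_add[of s "t - s" x] assms by (simp add: blinfun.diff_right)
  then show ?thesis using norm_T_le[of s "T (t - s) x - x"] assms by (simp add: displacement_def)
qed

text \<open>Right continuity at \<open>0\<close> spreads by \<open>T_diff_le\<close>, which depends
  on the difference of the two times only. The same \<open>d\<close> thus works at every point and
  on both sides of it.\<close>

lemma continuous_orbit: "continuous_on {0..} (\<lambda>t. T t x)"
  unfolding continuous_on_iff
proof (intro ballI allI impI)
  fix t e :: real assume t: "t \<in> {0..}" and "e > 0"
  with M_ge_1 have "e / M > 0" by simp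
  from order_tendstoD(2)[OF displacement_tendsto[of x] this]
  obtain d where "d > 0" and d: "\<And>h. 0 < h \<Longrightarrow> h < d \<Longrightarrow> displacement x h < e / M"
    by (auto simp: eventually_at_right_field)
  have small: "norm (T b x - T a x) < e" if "0 \<le> a" "a \<le> b" "b - a < d" for a b
  proof -
    have "displacement x (b - a) < e / M"
      using d[of "b - a"] that \<open>e / M > 0\<close> by (cases "a = b") auto
    then have "M * displacement x (b - a) < e" using M_ge_1 by (simp add: field_simps)
    then show ?thesis using T_diff_le[of a b x] that by simp
  qed
  show "\<exists>d>0. \<forall>t'\<in>{0..}. dist t' t < d \<longrightarrow> dist (T t' x) (T t x) < e"
  proof (intro exI conjI ballI impI)
    fix t' assume "t' \<in> {0..}" "dist t' t < d"
    then show "dist (T t' x) (T t x) < e"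
      using small[of t t'] small[of t' t] t
      by (cases "t \<le> t'") (auto simp: dist_norm norm_minus_commute)
  qed fact
qed

lemma continuous_displacement: "continuous_on {0..} (displacement x)"
  unfolding displacement_def by (intro continuous_intros continuous_orbit)

text \<open>Telescoping over \<open>n\<close> steps. Each step is compared directly with the first
  one, so no powers of \<open>M\<close> accumulate.\<close>

lemma displacement_mult: "0 \<le> h \<Longrightarrow> displacement x (real n * h) \<le> real n * (M * displacement x h)"
proof (induction n)
  case (Suc n)
  have "norm (T (real (Suc n) * h) x - T (real n * h) x) \<le> M * displacement x h"
    using T_diff_le[of "real n * h" "real (Suc n) * h" x] Suc.prems by (simp add: algebra_simps)
  then have "displacement x (real (Suc n) * h) \<le> M * displacement x h + displacement x (real n * h)"
    unfolding displacement_def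
    using norm_triangle_ineq[of "T (real (Suc n) * h) x - T (real n * h) x" "T (real n * h) x - x"]
    by simp
  then show ?case using Suc by (simp add: algebra_simps)
qed (simp add: displacement_def)

section \<open>The generator and integrals of orbits\<close>

lemma generatorI:
  assumes "((\<lambda>h. (T h x - x) /\<^sub>R h) \<longlongrightarrow> y) (at_right 0)"
  shows "x \<in> D" and "A x = - y"
proof -
  show "x \<in> D" using gen assms by (auto simp: is_generator_def)
  then have "((\<lambda>h. (T h x - x) /\<^sub>R h) \<longlongrightarrow> - A x) (at_right 0)"
    using gen by (simp add: is_generator_def)
  from tendsto_unique[OF _ this assms] show "A x = - y" by (simp add: minus_equation_iff)
qed

lemma zero_in_D: "0 \<in> D" and A_zero: "A 0 = 0"
  using generatorI[of 0 0] by simp_all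

text \<open>Cut \<open>{0..t}\<close> into \<open>n\<close> equal steps: by
  \<open>displacement_mult\<close> the displacement is at most \<open>M * t\<close> times the norm
  of the difference quotient at \<open>t / n\<close>, which tends to
  \<open>norm (A b)\<close>.\<close>

lemma displacement_domain_le:
  assumes b: "b \<in> D" and "0 < t"
  shows "displacement b t \<le> M * t * norm (A b)"
proof -
  \<comment> \<open>\<open>Suc n\<close> keeps the number of steps positive.\<close>
  define h where "h = (\<lambda>n. t / real (Suc n))"
  have "filterlim h (at_right 0) sequentially"
    unfolding filterlim_at h_def using \<open>0 < t\<close> LIMSEQ_Suc[OF lim_const_over_n[of t]]
    by (auto intro!: always_eventually divide_pos_pos simp del: of_nat_Suc)
  moreover have "((\<lambda>h. (T h b - b) /\<^sub>R h) \<longlongrightarrow> - A b) (at_right 0)"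
    using gen b by (simp add: is_generator_def)
  ultimately have "(\<lambda>n. (T (h n) b - b) /\<^sub>R h n) \<longlonglongrightarrow> - A b"
    by (rule filterlim_compose[rotated])
  then have "(\<lambda>n. norm ((T (h n) b - b) /\<^sub>R h n)) \<longlonglongrightarrow> norm (- A b)"
    by (rule tendsto_norm)
  then have "(\<lambda>n. M * t * norm ((T (h n) b - b) /\<^sub>R h n)) \<longlonglongrightarrow> M * t * norm (A b)"
    by (intro tendsto_mult_left) simp
  moreover have "displacement b t \<le> M * t * norm ((T (h n) b - b) /\<^sub>R h n)" for n
  proof -
    have "norm ((T (h n) b - b) /\<^sub>R h n) = displacement b (h n) * (real (Suc n) / t)"
      using \<open>0 < t\<close> by (simp add: h_def displacement_def del: of_nat_Suc)
    then show ?thesis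
      using displacement_mult[of "h n" b "Suc n"] \<open>0 < t\<close> by (simp add: h_def mult_ac del: of_nat_Suc)
  qed
  ultimately show ?thesis by (intro LIMSEQ_le_const) auto
qed

text \<open>Applying \<open>T h\<close> shifts the window of integration by \<open>h\<close>. Only
  the two ends remain in the difference, and divided by \<open>h\<close> they tend to
  \<open>T t x\<close> and \<open>x\<close>.\<close>

lemma integral_orbit:
  assumes t: "0 \<le> t"
  shows "integral {0..t} (\<lambda>s. T s x) \<in> D"
    and "A (integral {0..t} (\<lambda>s. T s x)) = x - T t x"
proof -
  define f where "f = (\<lambda>s. T s x)"
  let ?b = "integral {0..t} f"
  have int: "f integrable_on {a..b}" if "0 \<le> a" for a b
    unfolding f_def using that
    by (intro integrable_continuous_real continuous_on_subset[OF continuous_orbit]) auto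
  \<comment> \<open>Splitting \<open>{0..t+h}\<close> once at \<open>h\<close> and once at
    \<open>t\<close> gives the cancellation for all positive \<open>h\<close>, including
    \<open>h > t\<close>.\<close>
  have diff: "T h ?b - ?b = integral {t..t+h} f - integral {0..h} f" if "0 < h" for h
  proof -
    have "T h ?b = integral {0..t} (\<lambda>s. T h (f s))"
      using integral_linear[OF int blinfun.bounded_linear_right[of "T h"]] by (simp add: o_def)
    also have "\<dots> = integral {0..t} (f \<circ> (+) h)"
      using T_add[of h _ x] that by (intro integral_cong) (auto simp: f_def)
    also have "\<dots> = integral {h..t+h} f" by (simp add: integral_shift_Icc_real)
    finally have "T h ?b = integral {h..t+h} f" .
    moreover have "integral {0..h} f + integral {h..t+h} f = integral {0..t+h} f"
      using t that by (intro Henstock_Kurzweil_Integration.integral_combine int) auto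
    moreover have "?b + integral {t..t+h} f = integral {0..t+h} f"
      using t that by (intro Henstock_Kurzweil_Integration.integral_combine int) auto
    ultimately show ?thesis by (simp add: algebra_simps)
  qed
  \<comment> \<open>The form \<open>0+h\<close> matches \<open>integral_average_tendsto\<close> at
    the point \<open>0\<close>.\<close>
  have "((\<lambda>h. integral {t..t+h} f /\<^sub>R h - integral {0..0+h} f /\<^sub>R h) \<longlongrightarrow> f t - f 0) (at_right 0)"
    unfolding f_def using t
    by (intro tendsto_diff integral_average_tendsto continuous_on_subset[OF continuous_orbit]) auto
  then have "((\<lambda>h. (T h ?b - ?b) /\<^sub>R h) \<longlongrightarrow> f t - f 0) (at_right 0)"
    by (rule Lim_transform_eventually)
      (auto simp: eventually_at_right_field diff simp flip: scaleR_diff_right intro!: exI[of _ 1])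
  from generatorI[OF this] show "integral {0..t} (\<lambda>s. T s x) \<in> D"
    and "A (integral {0..t} (\<lambda>s. T s x)) = x - T t x"
    by (simp_all add: f_def)
qed

lemma A_scaleR:
  assumes "b \<in> D"
  shows "c *\<^sub>R b \<in> D" and "A (c *\<^sub>R b) = c *\<^sub>R A b"
proof -
  have "((\<lambda>h. (T h b - b) /\<^sub>R h) \<longlongrightarrow> - A b) (at_right 0)"
    using gen assms by (simp add: is_generator_def)
  from tendsto_scaleR[OF tendsto_const[of c] this]
  have "((\<lambda>h. (T h (c *\<^sub>R b) - c *\<^sub>R b) /\<^sub>R h) \<longlongrightarrow> c *\<^sub>R - A b) (at_right 0)"
    by (simp add: blinfun.scaleR_right scaleR_diff_right mult.commute)
  from generatorI[OF this] show "c *\<^sub>R b \<in> D" "A (c *\<^sub>R b) = c *\<^sub>R A b" by simp_all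
qed

subsection \<open>The K-functional\<close>

abbreviation "K t x \<equiv> K_functional D A t x"

lemma graph_norm_nonneg: "0 \<le> graph_norm A b"
  by (simp add: graph_norm_def)

text \<open>The decomposition \<open>x = x + 0\<close> makes the set nonempty, which the real
  \<open>Inf\<close> requires here; in \<open>K_le\<close> it is the lower bound \<open>0\<close>
  that is required.\<close>

lemma K_greatest:
  assumes "\<And>a b. b \<in> D \<Longrightarrow> a + b = x \<Longrightarrow> c \<le> norm a + t * graph_norm A b"
  shows "c \<le> K t x"
  unfolding K_functional_def
proof (rule cInf_greatest)
  show "{norm a + t * graph_norm A b |a b. b \<in> D \<and> a + b = x} \<noteq> {}"
    using zero_in_D by (metis (mono_tags, lifting) add.right_neutral empty_iff mem_Collect_eq)
qed (use assms in auto)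

lemma K_le:
  assumes "0 \<le> t" "b \<in> D" "a + b = x"
  shows "K t x \<le> norm a + t * graph_norm A b"
  unfolding K_functional_def
proof (rule cInf_lower)
  show "bdd_below {norm a + t * graph_norm A b |a b. b \<in> D \<and> a + b = x}"
    using assms graph_norm_nonneg by (auto intro!: bdd_belowI[of _ 0] add_nonneg_nonneg)
qed (use assms in auto)

lemma K_nonneg: "0 \<le> t \<Longrightarrow> 0 \<le> K t x"
  by (rule K_greatest) (simp add: graph_norm_nonneg)

lemma K_le_norm: "0 \<le> t \<Longrightarrow> K t x \<le> norm x"
  using K_le[of t 0 x x] zero_in_D by (simp add: graph_norm_def A_zero)

text \<open>The cost of each decomposition increases with \<open>t\<close>. Measurability of
  \<open>K\<close> will rest on this.\<close>

lemma K_mono: "0 \<le> s \<Longrightarrow> s \<le> t \<Longrightarrow> K s x \<le> K t x"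
proof (rule K_greatest)
  fix a b assume "0 \<le> s" "s \<le> t" "b \<in> D" "a + b = x"
  then show "K s x \<le> norm a + t * graph_norm A b"
    using K_le[of s b a x] mult_right_mono[of s t "graph_norm A b"] graph_norm_nonneg[of b] by simp
qed

text \<open>Both coefficients \<open>1\<close> and \<open>t\<close> in the cost are at least
  \<open>min 1 t\<close>, and the graph norm dominates the norm; the triangle inequality does the
  rest.\<close>

lemma K_ge_min:
  assumes "0 < t"
  shows "min 1 t * norm x \<le> K t x"
proof (rule K_greatest)
  fix a b assume b: "a + b = x"
  have "min 1 t * norm x \<le> min 1 t * norm a + min 1 t * norm b"
    using norm_triangle_ineq[of a b] b assms by (simp flip: distrib_left add: mult_left_mono)
  also have "\<dots> \<le> norm a + t * graph_norm A b"
    using assms by (intro add_mono mult_left_le_one_le mult_mono) (auto simp: graph_norm_def)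
  finally show "min 1 t * norm x \<le> norm a + t * graph_norm A b" .
qed

lemma displacement_le_K:
  assumes "0 < t"
  shows "displacement x t \<le> (M + 1) * K t x"
proof -
  \<comment> \<open>Dividing by \<open>M + 1\<close> first yields a lower bound for every
    decomposition, which passes to the infimum.\<close>
  have "displacement x t / (M + 1) \<le> K t x"
  proof (rule K_greatest)
    fix a b assume b: "b \<in> D" "a + b = x"
    have "displacement x t \<le> displacement a t + displacement b t"
      using displacement_triangle b by blast
    also have "\<dots> \<le> (M + 1) * norm a + M * (t * norm (A b))"
      using displacement_le[of t a] displacement_domain_le[OF b(1) assms] assms by (simp add: mult.assoc)
    also have "M * (t * norm (A b)) \<le> (M + 1) * (t * graph_norm A b)"
      using assms M_ge_1 by (intro mult_mono) (auto simp: graph_norm_def)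
    finally show "displacement x t / (M + 1) \<le> norm a + t * graph_norm A b"
      using M_ge_1 by (simp add: field_simps)
  qed
  then show ?thesis using M_ge_1 by (simp add: field_simps)
qed

text \<open>With \<open>b\<close> the mean of the orbit over \<open>{0..t}\<close>, the three terms
  bound \<open>norm (x - b)\<close>, \<open>t * norm (A b)\<close> and \<open>t * norm b\<close> in
  this order.\<close>

lemma K_le_average:
  assumes t: "0 < t"
  shows "K t x \<le> integral {0..t} (displacement x) / t + displacement x t + t * (M * norm x)"
proof -
  define b where "b = (1 / t) *\<^sub>R integral {0..t} (\<lambda>s. T s x)"
  have c: "continuous_on {0..t} (\<lambda>s. T s x)" "continuous_on {0..t} (displacement x)"
    using continuous_on_subset[OF continuous_orbit] continuous_on_subset[OF continuous_displacement]
    by auto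
  have "x - b = (1 / t) *\<^sub>R integral {0..t} (\<lambda>s. x - T s x)"
    using t c(1) unfolding b_def
    by (subst integral_diff) (auto intro: integrable_continuous_real simp: scaleR_diff_right)
  moreover have "norm (integral {0..t} (\<lambda>s. x - T s x)) \<le> integral {0..t} (displacement x)"
    by (intro Henstock_Kurzweil_Integration.integral_norm_bound_integral
        integrable_continuous_real continuous_intros c)
      (simp add: displacement_def norm_minus_commute)
  ultimately have 1: "norm (x - b) \<le> integral {0..t} (displacement x) / t"
    using t by (simp add: divide_right_mono)
  have "A b = (1 / t) *\<^sub>R (x - T t x)" and bD: "b \<in> D"
    using integral_orbit[of t x] A_scaleR t unfolding b_def by auto
  then have 2: "t * norm (A b) = displacement x t"
    using t by (simp add: displacement_def norm_minus_commute)
  have "norm (integral {0..t} (\<lambda>s. T s x)) \<le> M * norm x * (t - 0)"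
    using t norm_T_le by (intro integral_bound c(1)) auto
  then have "norm b \<le> M * norm x" using t by (simp add: b_def field_simps)
  then have 3: "t * norm b \<le> t * (M * norm x)" using t by simp
  have "K t x \<le> norm (x - b) + t * graph_norm A b"
    using t bD by (intro K_le) auto
  then show ?thesis using 1 2 3 by (simp add: graph_norm_def distrib_left)
qed

section \<open>Measurability in \<open>t\<close>\<close>

lemma measurable_quotient:
  "(\<lambda>t. complex_of_real (displacement x t / t)) \<in> borel_measurable half_line"
proof -
  have [measurable]: "displacement x \<in> borel_measurable half_line"
    by (intro continuous_imp_measurable_on_sets_lebesgue continuous_displacement) simp
  have [measurable]: "(\<lambda>t. t) \<in> borel_measurable half_line"
    by (intro continuous_imp_measurable_on_sets_lebesgue continuous_intros) simp
  show ?thesis by measurable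
qed

lemma measurable_K: "(\<lambda>t. complex_of_real (K t x / t)) \<in> borel_measurable half_line"
proof -
  have "(\<lambda>t. K t x) \<in> borel_measurable (restrict_space borel {0..})"
    by (rule borel_measurable_mono_on_fnc) (auto intro: mono_onI K_mono)
  moreover have "(\<lambda>t. t) \<in> measurable half_line (restrict_space borel {0..})"
    by (intro measurable_restrict_space3 measurable_completion) auto
  ultimately have [measurable]: "(\<lambda>t. K t x) \<in> borel_measurable half_line"
    by (rule measurable_compose[rotated])
  have [measurable]: "(\<lambda>t. t) \<in> borel_measurable half_line"
    by (intro continuous_imp_measurable_on_sets_lebesgue continuous_intros) simp
  show ?thesis by measurable
qed

text \<open>
  If \<open>\<omega>(t)/t\<close> were small for arbitrarily small \<open>t\<close>, then \<open>\<omega>(s)\<close> would vanish for all \<open>s\<close>, as one sees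
  by going from \<open>0\<close> to \<open>s\<close> in steps of length \<open>t\<close>.
\<close>

lemma displacement_lower_bound:
  assumes "\<not> (x \<in> D \<and> A x = 0)"
  obtains c d where "0 < c" "0 < d" "\<And>t. 0 < t \<Longrightarrow> t < d \<Longrightarrow> c * t \<le> displacement x t"
proof -
  \<comment> \<open>A constant orbit has vanishing difference quotients, which would put
    \<open>x\<close> into the kernel of \<open>A\<close>.\<close>
  have "\<exists>s>0. displacement x s \<noteq> 0"
  proof (rule ccontr)
    assume "\<not> ?thesis"
    then have "((\<lambda>h. (T h x - x) /\<^sub>R h) \<longlongrightarrow> 0) (at_right 0)"
      by (intro tendsto_eventually)
        (auto simp: eventually_at_right_field displacement_def intro!: exI[of _ 1])
    from generatorI[OF this] assms show False by simp
  qed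
  then obtain s where s: "0 < s" "0 < displacement x s"
    by (metis displacement_nonneg less_eq_real_def)
  \<comment> \<open>With this threshold a remainder shorter than \<open>d\<close> accounts for at
    most half of \<open>displacement x s\<close>; the whole steps of length \<open>t\<close> must
    account for the other half.\<close>
  have "0 < displacement x s / (2 * M)" using s M_ge_1 by simp
  from order_tendstoD(2)[OF displacement_tendsto[of x] this]
  obtain d where "0 < d" and d: "\<And>h. 0 < h \<Longrightarrow> h < d \<Longrightarrow> displacement x h < displacement x s / (2 * M)"
    by (auto simp: eventually_at_right_field)
  show thesis
  proof (rule that)
    show "0 < displacement x s / (2 * M * s)" using s M_ge_1 by simp
    show "0 < d" by fact
    fix t assume t: "0 < t" "t < d"
    define n where "n = nat \<lfloor>s / t\<rfloor>"
    define r where "r = s - real n * t"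
    have n: "real n \<le> s / t" "s / t < real n + 1"
      using s t by (simp_all add: n_def)
    then have r: "0 \<le> r" "r < t" "real n * t \<le> s" using t by (simp_all add: r_def field_simps)
    have "M * displacement x r \<le> displacement x s / 2"
    proof (cases "r = 0")
      case False
      with d[of r] r t have "displacement x r < displacement x s / (2 * M)" by simp
      then show ?thesis using M_ge_1 by (simp add: field_simps)
    qed (use s in simp)
    moreover have "norm (T s x - T (real n * t) x) \<le> M * displacement x r"
      using T_diff_le[of "real n * t" s x] t r by (simp add: r_def)
    moreover have "displacement x s \<le> norm (T s x - T (real n * t) x) + displacement x (real n * t)"
      unfolding displacement_def
      using norm_triangle_ineq[of "T s x - T (real n * t) x" "T (real n * t) x - x"] by simp
    moreover have "displacement x (real n * t) \<le> real n * (M * displacement x t)"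
      using displacement_mult t by simp
    moreover have "real n * (M * displacement x t) \<le> s / t * (M * displacement x t)"
      using n M_ge_1 by (intro mult_right_mono) auto
    ultimately have "displacement x s / 2 \<le> s / t * (M * displacement x t)" by linarith
    then show "displacement x s / (2 * M * s) * t \<le> displacement x t"
      using s t M_ge_1 by (simp add: field_simps)
  qed
qed

end

subsection \<open>The interpolation space\<close>

locale semigroup_interpolation =
  bounded_semigroup T M D A + banach_function_space \<Phi> N
  for T :: "real \<Rightarrow> 'a::banach \<Rightarrow>\<^sub>L 'a" and M D A \<Phi> N +
  fixes H :: real
  assumes Phi_L1_loc: "\<Phi> \<subseteq> L1_loc"
    and H_nonneg: "0 \<le> H"
    and hardy_in: "f \<in> \<Phi> \<Longrightarrow> hardy f \<in> \<Phi>"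
    and hardy_le: "f \<in> \<Phi> \<Longrightarrow> N (hardy f) \<le> H * N f"
    and admissible: "kernel_admissible \<Phi> D A"
begin

text \<open>\<open>quot x\<close>, \<open>Kquot x\<close> and \<open>weight\<close> are the
  functions \<phi>, k and m of the sketch, made complex to be candidates for \<open>\<Phi>\<close>.
  At \<open>t = 0\<close> all three are \<open>0\<close>, by the convention for division by
  zero.\<close>

definition quot :: "'a \<Rightarrow> real \<Rightarrow> complex"
  where "quot x t = complex_of_real (displacement x t / t)"

definition Kquot :: "'a \<Rightarrow> real \<Rightarrow> complex"
  where "Kquot x t = complex_of_real (K t x / t)"

definition weight :: "real \<Rightarrow> complex"
  where "weight t = complex_of_real (min 1 (1 / t))"

lemma measurable_weight: "weight \<in> borel_measurable half_line"
proof -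
  have [measurable]: "(\<lambda>t. t) \<in> borel_measurable half_line"
    by (intro continuous_imp_measurable_on_sets_lebesgue continuous_intros) simp
  show ?thesis unfolding weight_def by measurable
qed

lemma cmod_weight: "0 \<le> t \<Longrightarrow> cmod (weight t) = min 1 (1 / t)"
  by (simp add: weight_def)

lemma norm_weight_pos: "weight \<in> \<Phi> \<Longrightarrow> 0 < N weight"
  by (rule norm_pos) (auto simp: weight_def min_def)

lemma cmod_quot: "0 \<le> t \<Longrightarrow> cmod (quot x t) = displacement x t / t"
  unfolding quot_def norm_of_real by simp

lemma cmod_Kquot: "0 \<le> t \<Longrightarrow> cmod (Kquot x t) = K t x / t"
  unfolding Kquot_def norm_of_real by (simp add: K_nonneg)

section \<open>Comparison of the quotients in the function space\<close>

lemma quot_in_if_Kquot_in: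
  assumes "Kquot x \<in> \<Phi>"
  shows "quot x \<in> \<Phi>" and "N (quot x) \<le> (M + 1) * N (Kquot x)"
proof -
  have le: "cmod (quot x t) \<le> (M + 1) * cmod (Kquot x t)" if "0 \<le> t" for t
    using displacement_le_K[of t x] that
    by (cases "t = 0") (auto simp: cmod_quot cmod_Kquot divide_right_mono)
  have meas: "quot x \<in> borel_measurable half_line"
    unfolding quot_def by (rule measurable_quotient)
  show "quot x \<in> \<Phi>" "N (quot x) \<le> (M + 1) * N (Kquot x)"
    using dominated[OF assms meas _ le] M_ge_1 by auto
qed

text \<open>Follows from \<open>K_ge_min\<close>. It provides the summand \<open>norm x\<close> of
  the equivalent norm, and shows that the interpolation space is trivial if \<open>weight\<close> is
  not in \<open>\<Phi>\<close>.\<close>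

lemma weight_in_if_Kquot_in:
  assumes "Kquot x \<in> \<Phi>" and "x \<noteq> 0"
  shows "weight \<in> \<Phi>" and "norm x * N weight \<le> N (Kquot x)"
proof -
  have le: "cmod (weight t) \<le> (1 / norm x) * cmod (Kquot x t)" if "0 \<le> t" for t
  proof (cases "t = 0")
    case False
    with that have "min 1 t * norm x / t \<le> K t x / t"
      using K_ge_min[of t x] by (intro divide_right_mono) auto
    moreover have "min 1 (1 / t) * norm x = min 1 t * norm x / t"
      using False that by (auto simp: min_def field_simps)
    ultimately have "min 1 (1 / t) * norm x \<le> K t x / t" by linarith
    then have "min 1 (1 / t) \<le> K t x / t / norm x" using \<open>x \<noteq> 0\<close>
      by (simp only: pos_le_divide_eq zero_less_norm_iff not_False_eq_True)
    then show ?thesis using that by (simp add: cmod_weight cmod_Kquot mult.commute[of t])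
  qed (simp add: cmod_weight cmod_Kquot)
  show "weight \<in> \<Phi>" using dominated[OF assms(1) measurable_weight _ le] by auto
  have "N weight \<le> (1 / norm x) * N (Kquot x)"
    using dominated[OF assms(1) measurable_weight _ le] by auto
  then show "norm x * N weight \<le> N (Kquot x)" using \<open>x \<noteq> 0\<close> by (simp add: field_simps)
qed

text \<open>Membership in \<open>L1_loc\<close> gives integrability up to \<open>0\<close> in spite
  of the factor \<open>1 / s\<close>.\<close>

lemma integral_quot:
  assumes "quot x \<in> \<Phi>" and "0 \<le> t"
  shows "(\<lambda>s. displacement x s / s) integrable_on {0..t}"
    and "hardy (quot x) t = complex_of_real (integral {0..t} (\<lambda>s. displacement x s / s) / t)"
    and "cmod (hardy (quot x) t) = integral {0..t} (\<lambda>s. displacement x s / s) / t"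
proof -
  have "(\<lambda>s. complex_of_real (displacement x s / s)) \<in> L1_loc"
    using assms Phi_L1_loc unfolding quot_def by auto
  note h = hardy_of_real[OF this assms(2)]
  show "(\<lambda>s. displacement x s / s) integrable_on {0..t}" by (rule h)
  show "hardy (quot x) t = complex_of_real (integral {0..t} (\<lambda>s. displacement x s / s) / t)"
    using h(2) unfolding quot_def .
  moreover have "0 \<le> integral {0..t} (\<lambda>s. displacement x s / s)"
    by (intro Henstock_Kurzweil_Integration.integral_nonneg h) auto
  ultimately show "cmod (hardy (quot x) t) = integral {0..t} (\<lambda>s. displacement x s / s) / t"
    using assms(2) by (simp only: norm_of_real) simp
qed

text \<open>Off the kernel of \<open>A\<close>, \<open>displacement x s / s\<close> is at least
  \<open>c\<close> near \<open>0\<close>, so its Hardy mean is at least a multiple of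
  \<open>min 1 (1 / t)\<close>. On the kernel the admissibility condition applies.\<close>

lemma weight_in_if_quot_in:
  assumes q: "quot x \<in> \<Phi>" and "x \<noteq> 0"
  shows "weight \<in> \<Phi>"
proof (cases "x \<in> D \<and> A x = 0")
  case True
  then show ?thesis
    using admissible \<open>x \<noteq> 0\<close> unfolding kernel_admissible_def weight_def by auto
next
  case False
  then obtain c d where c: "0 < c" "0 < d" "\<And>t. 0 < t \<Longrightarrow> t < d \<Longrightarrow> c * t \<le> displacement x t"
    using displacement_lower_bound by blast
  \<comment> \<open>\<open>e < d\<close> keeps \<open>{0..e}\<close> inside the range of the lower
    bound, and \<open>e \<le> 1\<close> gives
    \<open>e * min 1 (1 / t) \<le> min t e / t\<close>.\<close>
  define e where "e = min 1 (d / 2)"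
  have e: "0 < e" "e \<le> 1" "e < d" using c by (auto simp: e_def)
  have le: "cmod (weight t) \<le> (1 / (c * e)) * cmod (hardy (quot x) t)" if "0 \<le> t" for t
  proof (cases "t = 0")
    case False
    with that have t: "0 < t" by simp
    define r where "r = min t e"
    have r: "0 < r" "r \<le> t" "r < d" using t e by (auto simp: r_def)
    note int = integral_quot(1)[OF q]
    \<comment> \<open>\<open>displacement x s / s\<close> has the junk value \<open>0\<close> at \<open>s = 0\<close>.\<close>
    have "((\<lambda>s. if s = 0 then 0 else c) has_integral r * c) {0..r}"
    proof (rule has_integral_spike_finite[of "{0}"])
      show "((\<lambda>s. c) has_integral r * c) {0..r}" using has_integral_const_real[of c 0 r] r by simp
    qed auto
    then have "r * c \<le> integral {0..r} (\<lambda>s. displacement x s / s)"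
    proof (rule has_integral_le[OF _ integrable_integral])
      show "(if s = 0 then 0 else c) \<le> displacement x s / s" if "s \<in> {0..r}" for s
        using c(3)[of s] r that by (auto simp: field_simps)
    qed (use int r in auto)
    also have "\<dots> \<le> integral {0..t} (\<lambda>s. displacement x s / s)"
      using r by (intro integral_subset_le int) auto
    finally have "r * c / t \<le> cmod (hardy (quot x) t)"
      using t by (simp add: integral_quot(3)[OF q] divide_right_mono)
    moreover have "e * min 1 (1 / t) \<le> r / t"
      using t e by (auto simp: r_def min_def field_simps)
    then have "c * (e * min 1 (1 / t)) \<le> c * (r / t)" using c by (intro mult_left_mono) auto
    ultimately have "c * e * min 1 (1 / t) \<le> cmod (hardy (quot x) t)" by (simp add: mult_ac)
    then show ?thesis using t c e by (simp add: cmod_weight field_simps)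
  qed (use c e in \<open>simp add: cmod_weight\<close>)
  show ?thesis by (rule dominated[OF hardy_in[OF q] measurable_weight _ le]) (use c e in auto)
qed

text \<open>For \<open>t \<le> 1\<close> the weight is \<open>1\<close> off \<open>t = 0\<close> and
  \<open>K_le_average\<close> is divided by \<open>t\<close>. For \<open>t > 1\<close> the weight is
  \<open>1 / t\<close> and \<open>K t x \<le> norm x\<close> suffices.\<close>

lemma K_le_hardy:
  assumes q: "quot x \<in> \<Phi>" and t: "0 \<le> t"
  shows "cmod (Kquot x t)
    \<le> cmod (hardy (quot x) t) + cmod (quot x t) + M * norm x * cmod (weight t)"
proof (cases "t \<le> 1")
  case True
  show ?thesis
  proof (cases "t = 0")
    case False
    with t have t: "0 < t" by simp
    have c: "continuous_on {0..t} (displacement x)"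
      using continuous_on_subset[OF continuous_displacement] by auto
    have "integral {0..t} (displacement x) / t = integral {0..t} (\<lambda>s. displacement x s / t)"
      by simp
    \<comment> \<open>Here \<open>1 / t \<le> 1 / s\<close> for positive \<open>s\<close>; at
      \<open>s = 0\<close> both sides vanish.\<close>
    also have "\<dots> \<le> integral {0..t} (\<lambda>s. displacement x s / s)"
    proof (rule integral_le)
      show "(\<lambda>s. displacement x s / t) integrable_on {0..t}"
        using t by (intro integrable_continuous_real continuous_intros c) auto
      show "(\<lambda>s. displacement x s / s) integrable_on {0..t}"
        using integral_quot(1)[OF q] t by simp
      fix s assume "s \<in> {0..t}"
      then show "displacement x s / t \<le> displacement x s / s"
        using t by (cases "s = 0") (auto intro: divide_left_mono)
    qed
    finally have "K t x \<le> integral {0..t} (\<lambda>s. displacement x s / s) + displacement x t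
        + t * (M * norm x)"
      using K_le_average[OF t, of x] by linarith
    then have "K t x / t \<le> (integral {0..t} (\<lambda>s. displacement x s / s) + displacement x t
        + t * (M * norm x)) / t"
      using t by (intro divide_right_mono) auto
    then show ?thesis
      using t True by (simp add: cmod_Kquot cmod_quot cmod_weight integral_quot(3)[OF q] add_divide_distrib)
  qed (use M_ge_1 in \<open>simp add: cmod_Kquot cmod_weight\<close>)
next
  case False
  have "K t x / t \<le> norm x / t" using K_le_norm t by (simp add: divide_right_mono)
  also have "\<dots> \<le> M * norm x / t"
    using M_ge_1 t by (intro divide_right_mono) (auto simp: mult_le_cancel_right1)
  also have "\<dots> = M * norm x * cmod (weight t)" using False by (simp add: cmod_weight)
  finally show ?thesis using t by (simp add: cmod_Kquot add_increasing)
qed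

lemma Kquot_in_if_quot_in:
  assumes q: "quot x \<in> \<Phi>" and w: "weight \<in> \<Phi>"
  shows "Kquot x \<in> \<Phi>" and "N (Kquot x) \<le> (H + 1) * N (quot x) + M * norm x * N weight"
proof -
  have meas [measurable]: "hardy (quot x) \<in> borel_measurable half_line"
    "quot x \<in> borel_measurable half_line"
    using measurable hardy_in q by auto
  \<comment> \<open>Passing to moduli makes the summands nonnegative, so that the modulus of their
    sum is the sum of the moduli; by the ideal property the norms do not grow.\<close>
  let ?p = "\<lambda>t. complex_of_real (cmod (hardy (quot x) t))"
  let ?q = "\<lambda>t. complex_of_real (cmod (quot x t))"
  let ?w = "\<lambda>t. complex_of_real (M * norm x) * weight t"
  have p: "?p \<in> \<Phi>" "N ?p \<le> 1 * N (hardy (quot x))"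
    by (rule dominated[OF hardy_in[OF q], where c = 1]; simp)+
  have q': "?q \<in> \<Phi>" "N ?q \<le> 1 * N (quot x)"
    by (rule dominated[OF q, where c = 1]; simp)+
  have w': "?w \<in> \<Phi>" "N ?w = M * norm x * N weight"
    using scale[OF w] norm_scale[OF w, of "complex_of_real (M * norm x)"] M_ge_1
    by (auto simp: norm_mult)
  have pq: "(\<lambda>t. ?p t + ?q t) \<in> \<Phi>" by (intro add p q')
  have g: "(\<lambda>t. (?p t + ?q t) + ?w t) \<in> \<Phi>" by (intro add[OF pq] w')
  have le: "cmod (Kquot x t) \<le> 1 * cmod ((?p t + ?q t) + ?w t)" if "0 \<le> t" for t
  proof -
    have "weight t = complex_of_real (cmod (weight t))"
      using that by (simp add: cmod_weight weight_def)
    then have "(?p t + ?q t) + ?w t = complex_of_real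
        (cmod (hardy (quot x) t) + cmod (quot x t) + M * norm x * cmod (weight t))"
      by (metis of_real_add of_real_mult)
    then show ?thesis
      using K_le_hardy[OF q that] by (simp only: norm_of_real mult_1 order_trans[OF _ abs_ge_self])
  qed
  have meas_K: "Kquot x \<in> borel_measurable half_line"
    unfolding Kquot_def by (rule measurable_K)
  show "Kquot x \<in> \<Phi>" by (rule dominated(1)[OF g meas_K _ le]) auto
  have "N (Kquot x) \<le> 1 * N (\<lambda>t. (?p t + ?q t) + ?w t)"
    by (rule dominated(2)[OF g meas_K _ le]) auto
  also have "\<dots> \<le> N (hardy (quot x)) + N (quot x) + M * norm x * N weight"
    using norm_triangle[OF pq w'(1)] norm_triangle[OF p(1) q'(1)] p q' w' by simp
  finally show "N (Kquot x) \<le> (H + 1) * N (quot x) + M * norm x * N weight"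
    using hardy_le[OF q] by (simp add: algebra_simps)
qed

text \<open>The vector \<open>0\<close> is treated apart, since \<open>weight\<close> may lie
  outside \<open>\<Phi>\<close>; its \<open>Kquot\<close> vanishes on the half-line.\<close>

lemma interp_space_iff: "Kquot x \<in> \<Phi> \<longleftrightarrow> quot x \<in> \<Phi>"
proof
  assume q: "quot x \<in> \<Phi>"
  show "Kquot x \<in> \<Phi>"
  proof (cases "x = 0")
    case True
    have "Kquot x \<in> borel_measurable half_line" unfolding Kquot_def by (rule measurable_K)
    then show ?thesis
      by (rule dominated(1)[OF zero, where c = 1])
        (use True K_le_norm[of _ "0::'a"] in \<open>auto simp: cmod_Kquot divide_nonpos_nonneg\<close>)
  next
    case False
    then show ?thesis using Kquot_in_if_quot_in weight_in_if_quot_in q by blast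
  qed
qed (rule quot_in_if_Kquot_in)

lemma interp_norm_equiv:
  "\<exists>c>0. \<exists>C>0. \<forall>x. Kquot x \<in> \<Phi> \<longrightarrow>
    c * (norm x + N (quot x)) \<le> N (Kquot x) \<and> N (Kquot x) \<le> C * (norm x + N (quot x))"
proof (cases "weight \<in> \<Phi>")
  case True
  let ?w = "N weight"
  have w: "0 < ?w" using True by (rule norm_weight_pos)
  \<comment> \<open>\<open>c\<close> comes from adding the bounds of \<open>norm x\<close> and
    \<open>N (quot x)\<close> by \<open>N (Kquot x)\<close>; \<open>C\<close> exceeds both
    coefficients of the converse estimate.\<close>
  define c where "c = 1 / (1 / ?w + (M + 1))"
  define C where "C = (H + 1) + M * ?w"
  have c0: "0 < 1 / ?w + (M + 1)" using w M_ge_1 by (simp add: add_pos_nonneg)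
  show ?thesis
  proof (intro exI conjI allI impI)
    show "0 < c" using c0 by (simp add: c_def)
    show "0 < C" using H_nonneg M_ge_1 w by (simp add: C_def add_pos_nonneg)
    fix x assume k: "Kquot x \<in> \<Phi>"
    note q = quot_in_if_Kquot_in[OF k]
    have "norm x * ?w \<le> N (Kquot x)"
      using weight_in_if_Kquot_in(2)[OF k] norm_nonneg[OF k] by (cases "x = 0") auto
    then have "norm x \<le> 1 / ?w * N (Kquot x)" using w by (simp add: field_simps)
    with q have "norm x + N (quot x) \<le> (1 / ?w + (M + 1)) * N (Kquot x)"
      by (simp add: distrib_right)
    then show "c * (norm x + N (quot x)) \<le> N (Kquot x)"
      using c0 by (simp add: c_def pos_divide_le_eq mult.commute)
    have "N (Kquot x) \<le> (H + 1) * N (quot x) + M * ?w * norm x"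
      using Kquot_in_if_quot_in(2)[OF q(1) True] by (simp add: mult_ac)
    also have "\<dots> \<le> C * N (quot x) + C * norm x"
      using H_nonneg M_ge_1 w norm_nonneg[OF q(1)]
      by (intro add_mono mult_right_mono) (auto simp: C_def)
    finally show "N (Kquot x) \<le> C * (norm x + N (quot x))" by (simp add: algebra_simps)
  qed
next
  case False
  \<comment> \<open>Without \<open>weight\<close> in \<open>\<Phi>\<close> only \<open>x = 0\<close>
    is left, so any positive constants will do.\<close>
  have "N (Kquot x) = 0 \<and> norm x + N (quot x) = 0" if k: "Kquot x \<in> \<Phi>" for x
  proof -
    have x: "x = 0" using weight_in_if_Kquot_in(1)[OF k] False by blast
    have "Kquot x t = 0" if "0 \<le> t" for t
      using K_le_norm[OF that, of x] K_nonneg[OF that, of x] x by (simp add: Kquot_def)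
    then have "N (Kquot x) = 0" using norm_eq_0_iff[OF k] by (auto intro: AE_I2)
    then show ?thesis using quot_in_if_Kquot_in[OF k] norm_nonneg x by fastforce
  qed
  then show ?thesis by (auto intro!: exI[of _ "1::real"])
qed

end

theorem theorem3p5:
  fixes T :: "real \<Rightarrow> 'a::banach \<Rightarrow>\<^sub>L 'a"
    and D :: "'a set" and A :: "'a \<Rightarrow> 'a"
    and \<Phi> :: "(real \<Rightarrow> complex) set" and N :: "(real \<Rightarrow> complex) \<Rightarrow> real"
  assumes "bounded_C0_semigroup T"
    and "is_generator T D (\<lambda>x. - A x)"
    and "banach_function_space \<Phi> N"
    and "hardy_bounded \<Phi> N"
    and "kernel_admissible \<Phi> D A"
  shows "interp_space \<Phi> D A =
      {x. (\<lambda>t. complex_of_real (norm (blinfun_apply (T t) x - x) / t)) \<in> \<Phi>} \<and>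
    (\<exists>c>0. \<exists>C>0. \<forall>x\<in>interp_space \<Phi> D A.
      c * (norm x + N (\<lambda>t. complex_of_real (norm (blinfun_apply (T t) x - x) / t)))
        \<le> interp_norm N D A x \<and>
      interp_norm N D A x
        \<le> C * (norm x + N (\<lambda>t. complex_of_real (norm (blinfun_apply (T t) x - x) / t))))"
proof -
  obtain M where C0: "C0_semigroup T" and M: "\<And>t. 0 \<le> t \<Longrightarrow> norm (T t) \<le> M"
    using assms(1) unfolding bounded_C0_semigroup_def by blast
  obtain H where "\<Phi> \<subseteq> L1_loc" and hardy: "\<And>f. f \<in> \<Phi> \<Longrightarrow> hardy f \<in> \<Phi>"
    "\<And>f. f \<in> \<Phi> \<Longrightarrow> N (hardy f) \<le> H * N f"
    using assms(4) unfolding hardy_bounded_def by blast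
  interpret \<Phi>: banach_function_space \<Phi> N by fact
  \<comment> \<open>The maxima meet the normalisations \<open>1 \<le> M\<close> and
    \<open>0 \<le> H\<close>; as \<open>N\<close> is nonnegative, enlarging \<open>H\<close>
    preserves the Hardy bound.\<close>
  interpret semigroup_interpolation T "max 1 M" D A \<Phi> N "max 0 H"
  proof
    fix f assume f: "f \<in> \<Phi>"
    have "H * N f \<le> max 0 H * N f" using \<Phi>.norm_nonneg[OF f] by (intro mult_right_mono) auto
    then show "N (hardy f) \<le> max 0 H * N f" using hardy(2)[OF f] by linarith
  qed (use C0 M hardy assms \<open>\<Phi> \<subseteq> L1_loc\<close> in \<open>auto simp: le_max_iff_disj\<close>)
  have "interp_space \<Phi> D A = {x. Kquot x \<in> \<Phi>}" and "interp_norm N D A = (\<lambda>x. N (Kquot x))"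
    by (simp_all add: interp_space_def interp_norm_def Kquot_def[abs_def] fun_eq_iff)
  moreover have "(\<lambda>t. complex_of_real (norm (T t x - x) / t)) = quot x" for x
    by (simp add: quot_def displacement_def fun_eq_iff)
  ultimately show ?thesis
    using interp_space_iff interp_norm_equiv by auto
qed

end
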